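(* Let $n$ be a positive integer and let $c>0$ and $x_0>0$ be real numbers such that for every real $t \geq x_0$ there is a prime $p$ with $$t < p \leq t\left(1+\frac{c}{\log^n t}\right).$$ Let $x \geq x_0$ be real and let $k = 1 + c/\log^n x$. Then $$R_1^{(k)} \leq kx.$$
   Context: $\pi(x)$ denotes the number of primes $\leq x$, and $\log^n x = (\log x)^n$ with $\log$ the natural logarithm. For real $k>1$ and a positive integer $m$, the $m$th $k$-Ramanujan prime is $$R_m^{(k)} = \min\{ M \in \mathbb{N} \mid \pi(x)-\pi(x/k) \geq m \text{ for every real } x \geq M\},$$ where $\mathbb{N}$ is the set of positive integers; this minimum exists by the Prime Number Theorem. In particular $R_1^{(k)}$ is the least positive integer $M$ such that for every real $x\ge M$ the interval $(x/k,x]$ contains a prime. *)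

theory Defs
  imports Complex_Main "HOL-Computational_Algebra.Primes"
begin

definition prime_count :: "real \<Rightarrow> nat" where
  "prime_count x = card {p::nat. prime p \<and> real p \<le> x}"

text \<open>
  The difference of prime counts is taken in the integers, since subtraction of naturals truncates.
  The least element exists for every real \<open>k > 1\<close> by the Prime Number Theorem, so the value
  is meaningful for those \<open>k\<close>.
\<close>
definition ramanujan_prime :: "real \<Rightarrow> nat \<Rightarrow> nat" where
  "ramanujan_prime k m =
     (LEAST M. 0 < M \<and>
        (\<forall>x::real. x \<ge> real M \<longrightarrow>
           int (prime_count x) - int (prime_count (x / k)) \<ge> int m))"

end

theory Submission
  imports Defs
begin

text \<open>
  For \<open>y \<ge> k x\<close> apply the hypothesis to \<open>t = y / k \<ge> x\<close>; since \<open>c / (ln t) ^ n \<le> k - 1\<close>, the prime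
  obtained lies in \<open>(y / k, y]\<close>. This alone only bounds the Ramanujan prime by \<open>\<lceil>k x\<rceil>\<close>. For
  \<open>\<lfloor>k x\<rfloor> \<le> y < k x\<close> the prime in \<open>(x, k x]\<close> is an integer, hence at most \<open>\<lfloor>k x\<rfloor> \<le> y\<close>, and it
  exceeds \<open>x > y / k\<close>, so \<open>\<lfloor>k x\<rfloor>\<close> itself is admissible.
\<close>

lemma finite_nat_real_le: "finite {p::nat. P p \<and> real p \<le> x}"
  by (rule finite_subset[of _ "{..nat \<lfloor>x\<rfloor>}"]) (auto simp: le_nat_floor)

text \<open>\<open>p\<close> is counted at \<open>z\<close> but not at \<open>y\<close>; finiteness
  turns the strict inclusion into a strict inequality of cardinalities.\<close>

lemma prime_count_less:
  assumes "prime (p::nat)" "y < real p" "real p \<le> z"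
  shows "prime_count y < prime_count z"
proof -
  have "y \<le> z" using assms(2,3) by linarith
  then have "{p::nat. prime p \<and> real p \<le> y} \<subseteq> {p::nat. prime p \<and> real p \<le> z}"
    by auto
  moreover have "p \<in> {p. prime p \<and> real p \<le> z}" "p \<notin> {p. prime p \<and> real p \<le> y}"
    using assms by simp_all
  ultimately have "{p::nat. prime p \<and> real p \<le> y} \<subset> {p::nat. prime p \<and> real p \<le> z}"
    by blast
  then show ?thesis
    unfolding prime_count_def by (rule psubset_card_mono[OF finite_nat_real_le])
qed

text \<open>One prime in the interval makes the difference of counts at least 1, so \<open>M\<close>
  is a candidate for the \<open>LEAST\<close>.\<close>

lemma ramanujan_prime_1_le:
  assumes "0 < M"
    and "\<And>y. y \<ge> real M \<Longrightarrow> \<exists>p::nat. prime p \<and> y / k < real p \<and> real p \<le> y"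
  shows "ramanujan_prime k 1 \<le> M"
  unfolding ramanujan_prime_def
proof (rule Least_le, intro conjI allI impI)
  fix y :: real assume "y \<ge> real M"
  then obtain p :: nat where "prime p" "y / k < real p" "real p \<le> y"
    using assms(2) by blast
  then have "prime_count (y / k) < prime_count y" by (rule prime_count_less)
  then show "int (prime_count y) - int (prime_count (y / k)) \<ge> int 1" by simp
qed (fact assms(1))

theorem proposition3p1:
  fixes n :: nat and c x0 x k :: real
  assumes "n > 0" and "c > 0" and "x0 > 0"
    and "\<And>t::real. t \<ge> x0 \<Longrightarrow>
           \<exists>p::nat. prime p \<and> t < real p \<and> real p \<le> t * (1 + c / (ln t) ^ n)"
    and "x \<ge> x0"
    and "k = 1 + c / (ln x) ^ n"
  shows "real (ramanujan_prime k 1) \<le> k * x"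
proof -
  have "x0 > 1"
  proof (rule ccontr)
    \<comment> \<open>At \<open>t = 1\<close> the quotient is \<open>c / 0 = 0\<close>, so the hypothesis asks for a prime in \<open>(1, 1]\<close>.\<close>
    assume "\<not> x0 > 1"
    then obtain p :: nat where "1 < real p" "real p \<le> 1 * (1 + c / (ln 1) ^ n)"
      using assms(4)[of 1] by auto
    then show False using \<open>n > 0\<close> by (simp add: power_0_left)
  qed
  with assms(5) have "x > 1" by simp
  \<comment> \<open>Positivity of \<open>ln x\<close> gives \<open>k > 1\<close> and makes
    \<open>c / (ln t) ^ n\<close> non-increasing for \<open>t \<ge> x\<close>.\<close>
  then have "ln x > 0" by simp
  with assms(2,6) have "k > 1" by simp
  obtain q :: nat where q: "prime q" "x < real q" "real q \<le> k * x"
    using assms(4)[OF assms(5)] unfolding assms(6) mult.commute[of x] by blast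
  define M where "M = nat \<lfloor>k * x\<rfloor>"
  have "q \<le> M" unfolding M_def using q(3) by (rule le_nat_floor)
  have "ramanujan_prime k 1 \<le> M"
  proof (rule ramanujan_prime_1_le)
    show "0 < M" using \<open>q \<le> M\<close> prime_gt_0_nat[OF q(1)] by simp
  next
    fix y assume y: "y \<ge> real M"
    show "\<exists>p::nat. prime p \<and> y / k < real p \<and> real p \<le> y"
    proof (cases "y \<ge> k * x")
      case False
      with \<open>k > 1\<close> have "y / k < x" by (simp add: pos_divide_less_eq mult.commute)
      then show ?thesis using q \<open>q \<le> M\<close> y by (intro exI[of _ q]) auto
    next
      case True
      define t where "t = y / k"
      have "x \<le> t" using True \<open>k > 1\<close> by (simp add: t_def pos_le_divide_eq mult.commute)
      have "c / (ln t) ^ n \<le> c / (ln x) ^ n"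
        using \<open>x \<le> t\<close> \<open>x > 1\<close> \<open>ln x > 0\<close> assms(2)
        by (intro divide_left_mono power_mono mult_pos_pos zero_less_power) auto
      \<comment> \<open>The factor at \<open>t\<close> is at most its value \<open>k\<close> at
        \<open>x\<close>, so the interval above \<open>t\<close> ends no later than
        \<open>t * k = y\<close>.\<close>
      then have "t * (1 + c / (ln t) ^ n) \<le> t * k"
        using \<open>x \<le> t\<close> \<open>x > 1\<close> assms(6) by (intro mult_left_mono) auto
      also have "t * k = y" using \<open>k > 1\<close> by (simp add: t_def)
      finally have le: "t * (1 + c / (ln t) ^ n) \<le> y" .
      obtain p :: nat where "prime p" "t < real p" "real p \<le> t * (1 + c / (ln t) ^ n)"
        using assms(4)[OF order_trans[OF assms(5) \<open>x \<le> t\<close>]] by blast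
      then show ?thesis unfolding t_def[symmetric] using order_trans[OF _ le] by blast
    qed
  qed
  then have "real (ramanujan_prime k 1) \<le> real M" by simp
  \<comment> \<open>\<open>nat\<close> sends negative integers to 0, so the bound rests on
    \<open>k * x\<close> being nonnegative.\<close>
  also have "real M \<le> k * x"
    using \<open>x > 1\<close> \<open>k > 1\<close> unfolding M_def by (intro of_nat_floor) simp
  finally show ?thesis .
qed

end
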